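(* Let $B$ be a finite clean bidirected graph rooted at $r$, let $x\in V(B)\setminus\{r\}$, and let $\mathcal P$ and $\mathcal Q$ be sets of pairwise internally vertex-disjoint $r$--$x$ paths in $B$. Then there is a set $\mathcal R$ of pairwise internally vertex-disjoint $r$--$x$ paths in $B$ such that $\mathcal R$ contains the first edges of the paths in $\mathcal P$ and the last edges of the paths in $\mathcal Q$ (that is, each of these edges lies on some path in $\mathcal R$).
   Context: A bidirected graph $B=(G,\sigma)$ is a loopless multigraph $G$ together with a map $\sigma$ assigning to each half-edge $(e,u)$ ($u$ an endpoint of the edge $e$) a sign $\sigma(e,u)\in\{+,-\}$. An oriented edge $\vec e$ is an edge $e$ with a choice of which endpoint is its tail and which its head. A trail is a sequence $v_0\vec e_1v_1\dots\vec e_\ell v_\ell$ in which the edges $e_i$ are pairwise distinct, $\vec e_i$ has tail $v_{i-1}$ and head $v_i$, and $\sigma(e_{i+1},v_i)=-\sigma(e_i,v_i)$ for $1\le i<\ell$; it is a $v_0$--$v_\ell$ trail, trivial if $\ell=0$. A path is a trail that does not repeat vertices. An almost path is a trail that is trivial or becomes a path on removing its last edge (and last vertex). $B$ is rooted if it has a designated root vertex $r$; it is clean if there is no nontrivial $r$--$r$ almost path. *)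

theory Defs
  imports Main
begin

datatype sign = Plus | Minus

instantiation sign :: uminus
begin
definition "- s = (case s of Plus \<Rightarrow> Minus | Minus \<Rightarrow> Plus)"
instance ..
end

text \<open>
  \<^term>\<open>ends\<close> and \<^term>\<open>half_sign\<close> are total functions, but only their values at edges of the graph,
  respectively at half-edges \<open>(e, u)\<close> with \<open>u\<close> an end of the edge \<open>e\<close>, are ever relevant.
  Parallel edges are distinct elements of type \<open>'e\<close> with the same set of ends.
\<close>

record ('v, 'e) bigraph =
  verts :: "'v set"
  edges :: "'e set"
  ends :: "'e \<Rightarrow> 'v set"
  half_sign :: "'e \<Rightarrow> 'v \<Rightarrow> sign"

definition bidirected_graph :: "('v, 'e) bigraph \<Rightarrow> bool" where
  "bidirected_graph B \<longleftrightarrow> (\<forall>e \<in> edges B. ends B e \<subseteq> verts B \<and> card (ends B e) = 2)"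

definition finite_bidirected_graph :: "('v, 'e) bigraph \<Rightarrow> bool" where
  "finite_bidirected_graph B \<longleftrightarrow> bidirected_graph B \<and> finite (verts B) \<and> finite (edges B)"

record ('v, 'e) oriented_edge =
  tail :: 'v
  edge :: 'e
  head :: 'v

definition oriented_edge_of :: "('v, 'e) bigraph \<Rightarrow> ('v, 'e) oriented_edge \<Rightarrow> bool" where
  "oriented_edge_of B a \<longleftrightarrow> edge a \<in> edges B \<and> ends B (edge a) = {tail a, head a}"

text \<open>
  The alternating sequence \<open>v\<^sub>0 e\<^sub>1 v\<^sub>1 \<dots> e\<^sub>l v\<^sub>l\<close> is stored as the list of its \<open>l + 1\<close> vertices and the
  list of its \<open>l\<close> oriented edges. As lists are indexed from 0, the edge \<open>e\<^sub>i\<close> is entry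
  \<open>i - 1\<close> of the second list.
\<close>

record ('v, 'e) walk =
  vseq :: "'v list"
  eseq :: "('v, 'e) oriented_edge list"

definition trail :: "('v, 'e) bigraph \<Rightarrow> ('v, 'e) walk \<Rightarrow> bool" where
  "trail B T \<longleftrightarrow>
     length (vseq T) = Suc (length (eseq T)) \<and>
     set (vseq T) \<subseteq> verts B \<and>
     distinct (map edge (eseq T)) \<and>
     (\<forall>i < length (eseq T).
        oriented_edge_of B (eseq T ! i) \<and>
        tail (eseq T ! i) = vseq T ! i \<and>
        head (eseq T ! i) = vseq T ! Suc i) \<and>
     (\<forall>i. Suc i < length (eseq T) \<longrightarrow>
        half_sign B (edge (eseq T ! Suc i)) (vseq T ! Suc i) =
        - half_sign B (edge (eseq T ! i)) (vseq T ! Suc i))"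

definition trivial :: "('v, 'e) walk \<Rightarrow> bool" where
  "trivial T \<longleftrightarrow> eseq T = []"

definition path :: "('v, 'e) bigraph \<Rightarrow> ('v, 'e) walk \<Rightarrow> bool" where
  "path B T \<longleftrightarrow> trail B T \<and> distinct (vseq T)"

definition remove_last :: "('v, 'e) walk \<Rightarrow> ('v, 'e) walk" where
  "remove_last T = \<lparr>vseq = butlast (vseq T), eseq = butlast (eseq T)\<rparr>"

definition almost_path :: "('v, 'e) bigraph \<Rightarrow> ('v, 'e) walk \<Rightarrow> bool" where
  "almost_path B T \<longleftrightarrow> trail B T \<and> (trivial T \<or> path B (remove_last T))"

definition joins :: "('v, 'e) walk \<Rightarrow> 'v \<Rightarrow> 'v \<Rightarrow> bool" where
  "joins T u v \<longleftrightarrow> hd (vseq T) = u \<and> last (vseq T) = v"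

definition clean :: "('v, 'e) bigraph \<Rightarrow> 'v \<Rightarrow> bool" where
  "clean B r \<longleftrightarrow> \<not> (\<exists>T. almost_path B T \<and> joins T r r \<and> \<not> trivial T)"

definition inner_verts :: "('v, 'e) walk \<Rightarrow> 'v set" where
  "inner_verts T = set (butlast (tl (vseq T)))"

definition edges_on :: "('v, 'e) walk \<Rightarrow> 'e set" where
  "edges_on T = edge ` set (eseq T)"

text \<open>The first and the last edge are meaningful for nontrivial trails only.\<close>

definition first_edge :: "('v, 'e) walk \<Rightarrow> 'e" where
  "first_edge T = edge (hd (eseq T))"

definition last_edge :: "('v, 'e) walk \<Rightarrow> 'e" where
  "last_edge T = edge (last (eseq T))"

definition disjoint_paths ::
    "('v, 'e) bigraph \<Rightarrow> 'v \<Rightarrow> 'v \<Rightarrow> ('v, 'e) walk set \<Rightarrow> bool" where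
  "disjoint_paths B u v \<P> \<longleftrightarrow>
     (\<forall>P \<in> \<P>. path B P \<and> joins P u v) \<and>
     pairwise (\<lambda>P Q. disjnt (inner_verts P) (inner_verts Q)) \<P>"

end

theory Submission
  imports Defs
begin

text \<open>
  Call a vertex \<open>v \<noteq> r\<close> \<^emph>\<open>double\<close> if paths from \<open>r\<close> can arrive at \<open>v\<close> with either sign. In a clean graph
  all paths from \<open>r\<close> to a given double vertex \<open>v\<close> share the last vertex before \<open>v\<close> that is not
  double (the base of the blossom of \<open>v\<close>): the blossoms behave like single vertices of a digraph.
  Paths of \<open>\<P>\<close> and \<open>\<Q>\<close> that meet at a non-double vertex arrive there with the same sign, so
  one can switch from one to the other. Choose a stable set \<open>S\<close> of such switching vertices, where
  each path of \<open>\<P>\<close> prefers early vertices and each path of \<open>\<Q>\<close> prefers late ones. Follow the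
  paths of \<open>\<P>\<close> up to \<open>S\<close> and those of \<open>\<Q>\<close> from \<open>S\<close> on. Stability excludes any other meeting
  of an initial with a final segment: at a non-double vertex directly, and at a
  double vertex because the two paths also meet in its base, with no vertex of \<open>S\<close> in between.
\<close>

subsection \<open>Bases and double vertices\<close>

lemma sign_minus_minus [simp]: "- (- s) = (s :: sign)"
  by (cases s) (simp_all add: uminus_sign_def)

lemma sign_minus_neq [simp]: "- s \<noteq> (s :: sign)" "s \<noteq> - s"
  by (cases s; simp add: uminus_sign_def)+

lemma sign_neq_iff: "s \<noteq> t \<longleftrightarrow> s = - (t :: sign)"
  by (cases s; cases t; simp add: uminus_sign_def)

text \<open>
  A state \<open>(v, s)\<close> stands for arriving at \<open>v\<close> through a half-edge of sign \<open>s\<close>. Trails become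
  walks in a digraph on the states that is invariant under reversing all arcs and applying \<open>opp\<close>.
\<close>

definition opp :: "'v \<times> sign \<Rightarrow> 'v \<times> sign" where
  "opp a = (fst a, - snd a)"

lemma fst_opp [simp]: "fst (opp a) = fst a"
  and opp_opp [simp]: "opp (opp a) = a"
  by (simp_all add: opp_def)

lemma opp_cases: "fst a = fst b \<Longrightarrow> b = a \<or> b = opp a"
  unfolding opp_def by (metis prod.collapse sign_neq_iff)

lemma fst_set_rev_opp [simp]: "fst ` set (rev (map opp xs)) = fst ` set xs"
  by (simp add: image_image)

text \<open>The blossom arguments need only two facts about the graph: trails can be reversed
  (\<open>skew\<close>), and no nontrivial almost path leads from the root back to it
  (\<open>no_return\<close>). Distinctness is asked of \<open>xs\<close> alone because the final
  vertex of an almost path may repeat an earlier one.\<close>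

locale clean_states =
  fixes E :: "'v \<times> sign \<Rightarrow> 'v \<times> sign \<Rightarrow> bool" and r :: 'v
  assumes skew: "E a b \<Longrightarrow> E (opp b) (opp a)"
    and no_return: "\<And>xs b. \<lbrakk>xs \<noteq> []; fst (hd xs) = r; successively E (xs @ [b]);
      distinct (map fst xs)\<rbrakk> \<Longrightarrow> fst b \<noteq> r"
begin

definition spath :: "('v \<times> sign) list \<Rightarrow> bool" where
  "spath xs \<longleftrightarrow> xs \<noteq> [] \<and> successively E xs \<and> distinct (map fst xs)"

definition reach :: "'v \<times> sign \<Rightarrow> bool" where
  "reach a \<longleftrightarrow> (\<exists>xs. spath xs \<and> fst (hd xs) = r \<and> last xs = a)"

text \<open>One-element lists reach both states at \<open>r\<close>, so the root would always
  qualify without the explicit exclusion.\<close>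

definition double :: "'v \<Rightarrow> bool" where
  "double v \<longleftrightarrow> v \<noteq> r \<and> (\<forall>s. reach (v, s))"

text \<open>By \<open>reach_not_double_base\<close>, every reachable vertex that is neither the root
  nor double carries such a state, whether or not a blossom is attached to it.\<close>

definition base :: "'v \<times> sign \<Rightarrow> bool" where
  "base a \<longleftrightarrow> reach a \<and> \<not> reach (opp a)"

lemma spath_prefix: "spath (xs @ ys) \<Longrightarrow> xs \<noteq> [] \<Longrightarrow> spath xs"
  by (auto simp: spath_def successively_append_iff)

lemma spath_suffix: "spath (xs @ ys) \<Longrightarrow> ys \<noteq> [] \<Longrightarrow> spath ys"
  by (auto simp: spath_def successively_append_iff)

lemma spath_append:
  assumes "spath xs" "spath ys" "E (last xs) (hd ys)" "fst ` set xs \<inter> fst ` set ys = {}"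
  shows "spath (xs @ ys)"
  using assms by (auto simp: spath_def successively_append_iff)

lemma spath_rev: "spath xs \<Longrightarrow> spath (rev (map opp xs))"
  unfolding spath_def
  by (auto simp: successively_map rev_map[symmetric] comp_def intro: successively_mono skew)

lemma doubleI: "fst a \<noteq> r \<Longrightarrow> reach a \<Longrightarrow> reach (opp a) \<Longrightarrow> double (fst a)"
  unfolding double_def by (metis opp_cases fst_conv)

lemma double_reach: "double (fst a) \<Longrightarrow> reach a"
  unfolding double_def by (metis prod.collapse)

lemma base_not_double: "base a \<Longrightarrow> \<not> double (fst a)"
  using double_reach[of "opp a"] by (auto simp: base_def)

lemma base_not_root: "base a \<Longrightarrow> fst a \<noteq> r"
proof
  assume "base a" "fst a = r"
  moreover have "reach (opp a)" if "fst a = r" using that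
    unfolding reach_def spath_def by (intro exI[of _ "[opp a]"]) auto
  ultimately show False by (auto simp: base_def)
qed

lemma reach_not_double_base: "reach a \<Longrightarrow> fst a \<noteq> r \<Longrightarrow> \<not> double (fst a) \<Longrightarrow> base a"
  using doubleI[of a] by (auto simp: base_def)

lemma base_unique: "base a \<Longrightarrow> reach b \<Longrightarrow> fst a = fst b \<Longrightarrow> a = b"
  using opp_cases[of a b] by (auto simp: base_def)

text \<open>If \<open>fst k\<close> were double, a path from the root arriving in
  \<open>opp k\<close> could continue along the reversed arc back to the root. This is the only
  appeal to \<open>no_return\<close>.\<close>

lemma neighbour_of_root_not_double:
  assumes "E a k" "fst a = r"
  shows "\<not> double (fst k)"
proof
  assume "double (fst k)"
  then have "reach (opp k)" by (intro double_reach) simp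
  then obtain xs where xs: "spath xs" "fst (hd xs) = r" "last xs = opp k"
    by (auto simp: reach_def)
  have "successively E (xs @ [opp a])"
    using xs skew[OF assms(1)] by (auto simp: spath_def successively_append_iff)
  then have "fst (opp a) \<noteq> r" using xs by (intro no_return) (auto simp: spath_def)
  then show False using assms(2) by simp
qed

text \<open>
  Follow \<open>p\<close> up to its first vertex on \<open>c\<close> and then \<open>c\<close>, forwards if both arrive there with the
  same sign and backwards otherwise.
\<close>

lemma crossing:
  assumes p: "spath p" and c: "spath c" and ne: "fst ` set p \<inter> fst ` set c \<noteq> {}"
  obtains (agree) p1 z p2 c1 c2 where "p = p1 @ z # p2" "c = c1 @ z # c2"
      "fst ` set p1 \<inter> fst ` set c = {}" "spath (p1 @ z # c2)"
  | (oppose) p1 z p2 c1 c2 where "p = p1 @ opp z # p2" "c = c1 @ z # c2"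
      "fst ` set p1 \<inter> fst ` set c = {}" "spath (p1 @ rev (map opp (c1 @ [z])))"
proof -
  have "\<exists>z\<in>set p. fst z \<in> fst ` set c" using ne by auto
  from split_list_first_prop[OF this] obtain p1 z p2 where
    z: "p = p1 @ z # p2" "fst z \<in> fst ` set c" "\<forall>y\<in>set p1. fst y \<notin> fst ` set c" by metis
  then obtain z' where z': "z' \<in> set c" "fst z' = fst z" by auto
  then obtain c1 c2 where c12: "c = c1 @ z' # c2" by (meson split_list)
  have dis: "fst ` set p1 \<inter> fst ` set c = {}" using z(3) by blast
  have join: "spath (p1 @ d)" if "spath d" "hd d = z" "fst ` set d \<subseteq> fst ` set c" for d
  proof (cases "p1 = []")
    case False
    have "E (last p1) z" using p False by (auto simp: z(1) spath_def successively_append_iff)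
    then show ?thesis using that dis False p spath_prefix[of p1 "z # p2"]
      by (intro spath_append) (auto simp: z(1))
  qed (use that in auto)
  show thesis
  proof (cases "z' = z")
    case True
    have "spath (z # c2)" using c c12 True spath_suffix by blast
    then have "spath (p1 @ z # c2)" by (rule join) (auto simp: c12 True)
    then show thesis using agree[OF z(1) _ dis] c12 True by blast
  next
    case False
    then have zz: "z = opp z'" using opp_cases[of z z'] z' by auto
    have "spath (c1 @ [z'])" using c c12 spath_prefix[of "c1 @ [z']" c2] by simp
    then have "spath (p1 @ rev (map opp (c1 @ [z'])))"
    proof (intro join spath_rev)
      show "hd (rev (map opp (c1 @ [z']))) = z" by (simp add: zz)
      show "fst ` set (rev (map opp (c1 @ [z']))) \<subseteq> fst ` set c"
        unfolding fst_set_rev_opp by (auto simp: c12)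
    qed
    then show thesis using oppose[of p1 z' p2 c1 c2] z(1) c12 dis by (simp only: zz)
  qed
qed

text \<open>Let a path from the root to \<open>hd c\<close> cross \<open>c\<close>. Turning
  backwards along \<open>c\<close> would end in \<open>opp (hd c)\<close>, which is unreachable for
  a base, so the path can follow \<open>c\<close> forwards to its end.\<close>

lemma reach_from_base:
  assumes b: "base (hd c)" and c: "spath c" and rc: "r \<notin> fst ` set c"
  shows "reach (last c)"
proof -
  have "reach (hd c)" using b by (simp add: base_def)
  then obtain p where p: "spath p" "fst (hd p) = r" "last p = hd c" by (auto simp: reach_def)
  have ne: "p \<noteq> []" "c \<noteq> []" using p c by (auto simp: spath_def)
  \<comment> \<open>As \<open>c\<close> avoids the root, the crossing is not at the first state of
    \<open>p\<close>, and every composite path still starts at \<open>r\<close>.\<close>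
  have hd1: "fst (hd (p1 @ ys)) = r" if "p = p1 @ z # p2" "fst z \<in> fst ` set c" for p1 z p2 ys
    using that p(2) rc by (cases p1) auto
  have "hd c \<in> set p" using p(3) ne by (metis last_in_set)
  then have "fst ` set p \<inter> fst ` set c \<noteq> {}" using ne by (auto intro!: imageI)
  with p(1) c show ?thesis
  proof (cases rule: crossing)
    case (agree p1 z p2 c1 c2)
    then show ?thesis unfolding reach_def
      by (intro exI[of _ "p1 @ z # c2"]) (auto intro!: hd1)
  next
    case (oppose p1 z p2 c1 c2)
    have "hd (c1 @ [z]) = hd c" using oppose(2) by (cases c1) auto
    then have "last (p1 @ rev (map opp (c1 @ [z]))) = opp (hd c)"
      by (simp add: last_rev hd_map hd_append split: if_splits)
    then have "reach (opp (hd c))" unfolding reach_def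
      using oppose by (intro exI[of _ "p1 @ rev (map opp (c1 @ [z]))"]) (auto intro!: hd1)
    then show ?thesis using b by (simp add: base_def)
  qed
qed

text \<open>The vertices of all such \<open>xs\<close> make up the blossom at \<open>b\<close>; the
  blossom is never formed as a set and is handled through these paths only.\<close>

definition blossom_path :: "'v \<times> sign \<Rightarrow> ('v \<times> sign) list \<Rightarrow> bool" where
  "blossom_path b xs \<longleftrightarrow> base b \<and> spath (b # xs) \<and> (\<forall>a\<in>set xs. double (fst a))"

lemma blossom_path_no_root: "blossom_path b xs \<Longrightarrow> r \<notin> fst ` set (b # xs)"
  using base_not_root[of b] by (auto simp: blossom_path_def double_def)

lemma base_notin_blossom_path:
  "blossom_path b xs \<Longrightarrow> base b' \<Longrightarrow> b' \<noteq> b \<Longrightarrow> fst b' \<notin> fst ` set (b # xs)"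
  using base_not_double[of b'] base_unique[of b' b] by (auto simp: blossom_path_def base_def)

section \<open>Uniqueness of the base of a blossom\<close>

lemma no_base_to_base:
  assumes "base (hd c)" "spath c" "base b" "last c = opp b" "r \<notin> fst ` set c"
  shows False
  using reach_from_base[of c] assms by (simp add: base_def)

text \<open>Let \<open>b # p\<close> cross \<open>b' # q\<close>; the new path starts in
  \<open>b\<close> because \<open>b\<close> lies off \<open>b' # q\<close>. Turning backwards would
  lead from \<open>b\<close> to \<open>opp b'\<close> away from the root, against
  \<open>no_base_to_base\<close>. So the path runs forwards along \<open>q\<close> and inherits its
  final state.\<close>

lemma blossom_path_change_base:
  assumes p: "blossom_path b p" and q: "blossom_path b' q" and bb: "b \<noteq> b'"
    and e: "fst (last (b # p)) = fst (last (b' # q))"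
  shows "\<exists>p'. blossom_path b p' \<and> last (b # p') = last (b' # q)"
proof -
  have sp: "spath (b # p)" "spath (b' # q)" using p q by (auto simp: blossom_path_def)
  have bn: "fst b \<notin> fst ` set (b' # q)"
    using base_notin_blossom_path[OF q _ bb] p by (simp add: blossom_path_def)
  have "last (b # p) \<in> set (b # p)" "last (b' # q) \<in> set (b' # q)" by (rule last_in_set; simp)+
  then have "fst ` set (b # p) \<inter> fst ` set (b' # q) \<noteq> {}" using e
    by (metis disjoint_iff image_eqI)
  with sp show ?thesis
  proof (cases rule: crossing)
    case (agree p1 z p2 c1 c2)
    then obtain p1' where p1: "p1 = b # p1'" using bn by (cases p1) auto
    have "set c2 \<subseteq> set q" using agree(2) by (cases c1) auto
    then have "blossom_path b (p1' @ z # c2)"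
      using agree p q by (auto simp: blossom_path_def p1)
    moreover have "last (b # p1' @ z # c2) = last (b' # q)" unfolding agree(2) by simp
    ultimately show ?thesis by blast
  next
    case (oppose p1 z p2 c1 c2)
    then obtain p1' where p1: "p1 = b # p1'" using bn by (cases p1) auto
    let ?d = "p1 @ rev (map opp (c1 @ [z]))"
    have "hd (c1 @ [z]) = b'" using oppose(2) by (cases c1) auto
    then have "last ?d = opp b'"
      by (simp add: last_rev hd_map hd_append split: if_splits)
    moreover have "r \<notin> fst ` set ?d"
    proof -
      have "set p1 \<subseteq> set (b # p)" "set (c1 @ [z]) \<subseteq> set (b' # q)"
        unfolding oppose(1,2) by auto
      then have "fst ` set ?d \<subseteq> fst ` set (b # p) \<union> fst ` set (b' # q)"
        unfolding set_append image_Un fst_set_rev_opp by blast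
      then show ?thesis using blossom_path_no_root[OF p] blossom_path_no_root[OF q] by blast
    qed
    ultimately have False using oppose(4) p q
      by (intro no_base_to_base[of ?d b']) (auto simp: p1 blossom_path_def)
    then show ?thesis ..
  qed
qed

text \<open>Split at the last vertex that is not double; one exists because the path starts at the
  root. It is not the root itself, whose out-neighbours are never double, so its state is a
  base.\<close>

lemma last_base:
  assumes "spath xs" "fst (hd xs) = r" "double (fst (last xs))"
  shows "\<exists>ys b zs. xs = ys @ b # zs \<and> zs \<noteq> [] \<and> blossom_path b zs"
proof -
  have ne: "xs \<noteq> []" using assms by (auto simp: spath_def)
  have "\<exists>y\<in>set xs. \<not> double (fst y)" using ne assms(2)
    by (intro bexI[of _ "hd xs"]) (auto simp: double_def)
  then obtain ys b zs where
    s: "xs = ys @ b # zs" "\<not> double (fst b)" "\<forall>z\<in>set zs. double (fst z)"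
    by (elim split_list_last_propE) blast
  have zs: "zs \<noteq> []" using s assms(3) by auto
  have sp: "spath (b # zs)" using assms(1) s(1) spath_suffix by blast
  have "spath (ys @ [b])" using assms(1) s(1) spath_prefix[of "ys @ [b]" zs] by simp
  then have "reach b" unfolding reach_def using assms(2) s(1)
    by (intro exI[of _ "ys @ [b]"]) (cases ys; auto)
  moreover have "fst b \<noteq> r"
  proof
    assume "fst b = r"
    moreover have "E b (hd zs)" using sp zs by (cases zs) (auto simp: spath_def)
    ultimately have "\<not> double (fst (hd zs))" using neighbour_of_root_not_double by blast
    then show False using s(3) zs by simp
  qed
  ultimately have "base b" using s(2) reach_not_double_base by blast
  then have "blossom_path b zs" using s sp by (simp add: blossom_path_def)
  then show ?thesis using s zs by blast
qed

text \<open>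
  If \<open>b \<noteq> b'\<close>, then the states of \<open>p\<close>, from the last one back to \<open>b\<close>, could all be reached
  from \<open>b'\<close> through double vertices, giving a path from \<open>b'\<close> that arrives at \<open>b\<close> with the wrong sign.
\<close>

lemma blossom_paths_same_base:
  assumes "blossom_path b p" "p \<noteq> []" "blossom_path b' q" "fst (last p) = fst (last (b' # q))"
  shows "b = b'"
proof (rule ccontr)
  assume bb: "b \<noteq> b'"
  show False using assms(1,2,3,4)
  proof (induction p arbitrary: q rule: rev_induct)
    case (snoc v p)
    have b: "base b" "base b'" using snoc.prems by (auto simp: blossom_path_def)
    have dv: "double (fst v)" using snoc.prems by (auto simp: blossom_path_def)
    then have "reach (opp v)" by (intro double_reach) simp
    then obtain xs where "spath xs" "fst (hd xs) = r" "last xs = opp v" by (auto simp: reach_def)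
    with last_base[of xs] dv obtain b'' t where t: "blossom_path b'' t" "last (b'' # t) = opp v"
      by fastforce
    \<comment> \<open>If the path to \<open>opp v\<close> comes out of a base other than
      \<open>b'\<close>, then \<open>q\<close>, which ends at the same vertex, allows
      \<open>blossom_path_change_base\<close> to replace that base by \<open>b'\<close>.\<close>
    obtain q' where q': "blossom_path b' q'" "last (b' # q') = opp v"
    proof (cases "b'' = b'")
      case False
      then show thesis using blossom_path_change_base[OF snoc.prems(3) t(1)] t(2) snoc.prems(4) that
        by auto
    qed (use t that in auto)
    \<comment> \<open>One step back along \<open>b # p\<close>: by \<open>skew\<close> the path to
      \<open>opp v\<close> extends to \<open>opp u\<close>, unless it has visited the vertex of
      \<open>u\<close> already.\<close>
    define u where "u = last (b # p)"
    have "E u v" using snoc.prems(1)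
      by (auto simp: blossom_path_def spath_def u_def successively_append_iff successively_Cons split: if_splits)
    then have E: "E (opp v) (opp u)" by (rule skew)
    have bp: "blossom_path b p" using snoc.prems(1) spath_prefix[of "b # p" "[v]"]
      by (auto simp: blossom_path_def)
    have ext: "spath (b' # q' @ [opp u])" if "fst u \<notin> fst ` set (b' # q')"
      using spath_append[of "b' # q'" "[opp u]"] q' E that
      by (auto simp: blossom_path_def spath_def)
    show False
    proof (cases "p = []")
      case True
      then have "u = b" by (simp add: u_def)
      moreover have "fst b \<notin> fst ` set (b' # q')"
        using base_notin_blossom_path[OF q'(1) b(1) bb] .
      ultimately show False
        using ext no_base_to_base[of "b' # q' @ [opp b]" b] b
          blossom_path_no_root[OF q'(1)] base_not_root[OF b(1)] by auto
    next
      case False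
      then have u: "u = last p" "double (fst u)" using bp by (auto simp: u_def blossom_path_def)
      \<comment> \<open>The induction hypothesis compares end vertices only, so the sign of arrival
        at \<open>u\<close> may be arbitrary: the extension of \<open>q'\<close> or a prefix of it
        will do.\<close>
      have "\<exists>q. blossom_path b' q \<and> fst (last (b' # q)) = fst u"
      proof (cases "fst u \<in> fst ` set (b' # q')")
        case False
        then show ?thesis using ext q' u
          by (intro exI[of _ "q' @ [opp u]"]) (auto simp: blossom_path_def)
      next
        case True
        then obtain a where a: "a \<in> set (b' # q')" "fst a = fst u" by (metis imageE)
        then obtain c1 c2 where c: "b' # q' = c1 @ a # c2" by (meson split_list)
        then have sp: "spath (c1 @ [a])" using q' spath_prefix[of "c1 @ [a]" c2]
          by (simp add: blossom_path_def)
        obtain q'' where q'': "c1 @ [a] = b' # q''" using c by (cases c1) auto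
        then have "set q'' \<subseteq> set q'" using c by (cases c1) auto
        then have "blossom_path b' q''" using q' sp by (auto simp: blossom_path_def q'')
        moreover have "fst (last (b' # q'')) = fst u" using a(2) by (simp add: q''[symmetric])
        ultimately show ?thesis by blast
      qed
      then show False using snoc.IH[OF bp False] u(1) snoc.prems(3) by metis
    qed
  qed simp
qed

end

subsection \<open>Stable sets for two orders\<close>

text \<open>
  This is deferred acceptance: \<open>X\<close> below is a smallest set of candidates not yet rejected, and
  each rejected candidate is dominated in \<open>lt2\<close> by a current \<open>lt1\<close>-minimal one.
\<close>

lemma kernel_of_two_orders:
  fixes lt1 lt2 :: "'a \<Rightarrow> 'a \<Rightarrow> bool"
  assumes "finite C"
    and irr1: "\<And>a. \<not> lt1 a a" and tr1: "\<And>a b c. lt1 a b \<Longrightarrow> lt1 b c \<Longrightarrow> lt1 a c"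
    and irr2: "\<And>a. \<not> lt2 a a" and tr2: "\<And>a b c. lt2 a b \<Longrightarrow> lt2 b c \<Longrightarrow> lt2 a c"
  shows "\<exists>S\<subseteq>C. (\<forall>c\<in>S. \<forall>d\<in>S. \<not> lt1 c d \<and> \<not> lt2 c d) \<and>
           (\<forall>c\<in>C - S. (\<exists>d\<in>S. lt1 d c) \<or> (\<exists>d\<in>S. lt2 c d))"
proof -
  define mins where "mins X = {c\<in>X. \<forall>d\<in>X. \<not> lt1 d c}" for X
  define inv where "inv X \<longleftrightarrow> X \<subseteq> C \<and> (\<forall>c\<in>C - X. \<exists>d\<in>mins X. lt2 c d)" for X
  have "inv C" by (simp add: inv_def)
  then obtain X where X: "inv X" "\<And>Y. inv Y \<Longrightarrow> card X \<le> card Y"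
    by (metis ex_has_least_nat)
  have fin: "finite X" using X(1) assms(1) finite_subset by (auto simp: inv_def)
  have anti2: "\<not> lt2 c d" if cd: "c \<in> mins X" "d \<in> mins X" for c d
  proof
    assume lt: "lt2 c d"
    then have "c \<noteq> d" using irr2 by auto
    have m: "e \<in> mins (X - {c})" if "e \<in> mins X" "e \<noteq> c" for e
      using that by (auto simp: mins_def)
    \<comment> \<open>Rejecting \<open>c\<close> as well keeps the invariant, against the choice of
      \<open>X\<close> with least cardinality.\<close>
    have "inv (X - {c})"
      unfolding inv_def
    proof (intro conjI ballI)
      show "X - {c} \<subseteq> C" using X(1) by (auto simp: inv_def)
      fix a assume a: "a \<in> C - (X - {c})"
      show "\<exists>d\<in>mins (X - {c}). lt2 a d"
      proof (cases "a = c")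
        case True
        then show ?thesis using m[OF cd(2)] lt \<open>c \<noteq> d\<close> by auto
      next
        case False
        then obtain e where "e \<in> mins X" "lt2 a e" using a X(1) by (auto simp: inv_def)
        \<comment> \<open>If the witness \<open>e\<close> is the removed \<open>c\<close>, then
          \<open>d\<close> replaces it by transitivity.\<close>
        then show ?thesis using m[OF cd(2)] m[of e] lt \<open>c \<noteq> d\<close> tr2 by metis
      qed
    qed
    moreover have "c \<in> X" using cd by (simp add: mins_def)
    ultimately show False using X(2)[of "X - {c}"] fin
      by (metis card_Diff1_less linorder_not_less)
  qed
  have below: "\<exists>d\<in>mins X. lt1 d c" if "c \<in> X" "c \<notin> mins X" for c
  proof -
    let ?Y = "{d\<in>X. lt1 d c}"
    have "finite ?Y" "?Y \<noteq> {}" using fin that by (auto simp: mins_def)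
    moreover have "asymp_on ?Y lt1" using irr1 tr1 by (metis asymp_onI)
    moreover have "transp_on ?Y lt1" using tr1 by (metis transp_onI)
    ultimately obtain d where "d \<in> ?Y" "\<forall>e\<in>?Y. e \<noteq> d \<longrightarrow> \<not> lt1 e d"
      using Finite_Set.bex_min_element[of ?Y lt1] by blast
    then have d: "d \<in> ?Y" "\<forall>e\<in>?Y. \<not> lt1 e d" using irr1 by metis+
    then have "d \<in> mins X" using tr1 by (auto simp: mins_def)
    then show ?thesis using d by auto
  qed
  have "mins X \<subseteq> C" using X(1) by (auto simp: inv_def mins_def)
  moreover have "\<not> lt1 c d" if "c \<in> mins X" "d \<in> mins X" for c d
    using that by (auto simp: mins_def)
  moreover have "(\<exists>d\<in>mins X. lt1 d c) \<or> (\<exists>d\<in>mins X. lt2 c d)" if "c \<in> C - mins X" for c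
    using that below X(1) by (cases "c \<in> X") (auto simp: inv_def)
  ultimately show ?thesis using anti2 by (intro exI[of _ "mins X"]) auto
qed

subsection \<open>Trails and their states\<close>

text \<open>Distinctness of the edges comes for free. An edge used at \<open>i < j\<close> forces
  \<open>vseq T ! j\<close> to be an end of the earlier use, hence \<open>j = Suc i\<close>; but
  then the sign rule at that vertex would equate a sign with its negative.\<close>

lemma trailI:
  assumes len: "length (vseq T) = Suc (length (eseq T))" and verts: "set (vseq T) \<subseteq> verts B"
    and dist: "distinct (butlast (vseq T))"
    and edges: "\<And>i. i < length (eseq T) \<Longrightarrow> oriented_edge_of B (eseq T ! i) \<and>
        tail (eseq T ! i) = vseq T ! i \<and> head (eseq T ! i) = vseq T ! Suc i"
    and signs: "\<And>i. Suc i < length (eseq T) \<Longrightarrow>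
        half_sign B (edge (eseq T ! Suc i)) (vseq T ! Suc i) =
        - half_sign B (edge (eseq T ! i)) (vseq T ! Suc i)"
  shows "trail B T"
proof -
  have neq: "edge (eseq T ! i) \<noteq> edge (eseq T ! j)" if ij: "i < j" "j < length (eseq T)" for i j
  proof
    assume eq: "edge (eseq T ! i) = edge (eseq T ! j)"
    then have "vseq T ! j \<in> {vseq T ! i, vseq T ! Suc i}"
      using edges[of i] edges[of j] ij by (auto simp: oriented_edge_of_def)
    moreover have "vseq T ! k = butlast (vseq T) ! k" if "k < length (eseq T)" for k
      using that len by (simp add: nth_butlast)
    ultimately have "butlast (vseq T) ! j \<in> {butlast (vseq T) ! i, butlast (vseq T) ! Suc i}"
      using ij by auto
    then have "j = Suc i" using nth_eq_iff_index_eq[OF dist] ij len by auto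
    then show False using signs[of i] eq ij by auto
  qed
  then have "distinct (map edge (eseq T))"
    unfolding distinct_conv_nth by (auto simp: nat_neq_iff) metis+
  then show ?thesis using assms by (auto simp: trail_def)
qed

lemma trail_remove_last:
  assumes "trail B T" "eseq T \<noteq> []"
  shows "trail B (remove_last T)"
proof -
  have len: "length (vseq T) = Suc (length (eseq T))" using assms by (simp add: trail_def)
  have e: "eseq (remove_last T) ! i = eseq T ! i" if "i < length (eseq T) - 1" for i
    using that by (simp add: remove_last_def nth_butlast)
  have v: "vseq (remove_last T) ! i = vseq T ! i" if "i < length (eseq T)" for i
    using that len by (simp add: remove_last_def nth_butlast)
  have "distinct (map edge (eseq (remove_last T)))"
    using assms(1) distinct_butlast[of "map edge (eseq T)"]
    by (simp add: remove_last_def trail_def map_butlast)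
  moreover have "set (vseq (remove_last T)) \<subseteq> verts B"
    using assms(1) by (auto simp: remove_last_def trail_def dest: in_set_butlastD)
  moreover have "length (eseq (remove_last T)) = length (eseq T) - 1"
    "length (vseq (remove_last T)) = length (eseq T)" "0 < length (eseq T)"
    using len assms(2) by (auto simp: remove_last_def)
  ultimately show ?thesis using assms(1) by (simp add: trail_def e v)
qed

text \<open>The edge leaves \<open>a\<close> through a half-edge of sign \<open>- snd a\<close>, the
  sign of \<open>opp a\<close>. This builds in the alternation rule and makes the relation
  skew-symmetric.\<close>

definition step :: "('v, 'e) bigraph \<Rightarrow> 'v \<times> sign \<Rightarrow> 'v \<times> sign \<Rightarrow> bool" where
  "step B a b \<longleftrightarrow> (\<exists>e\<in>edges B. ends B e = {fst a, fst b} \<and> fst a \<noteq> fst b \<and>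
     half_sign B e (fst a) = - snd a \<and> half_sign B e (fst b) = snd b)"

lemma step_opp: "step B a b \<Longrightarrow> step B (opp b) (opp a)"
  by (auto simp: step_def opp_def)

text \<open>Choose an edge for every step; \<open>trailI\<close> shows that the chosen edges are
  distinct. The vertex of \<open>b\<close> may repeat one of \<open>xs\<close>, so only an almost
  path results.\<close>

lemma walk_of_states:
  assumes B: "bidirected_graph B" and xs: "xs \<noteq> []" "successively (step B) (xs @ [b])"
    and dist: "distinct (map fst xs)"
  shows "\<exists>T. almost_path B T \<and> vseq T = map fst (xs @ [b])"
proof -
  define ys n where "ys = xs @ [b]" and "n = length xs"
  have "step B (ys ! i) (ys ! Suc i)" if "i < n" for i
    using xs(2) that unfolding ys_def n_def
    by (metis length_append_singleton Suc_less_eq successively_nth)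
  then obtain f where f: "\<And>i. i < n \<Longrightarrow> f i \<in> edges B \<and> ends B (f i) = {fst (ys ! i), fst (ys ! Suc i)} \<and>
      half_sign B (f i) (fst (ys ! i)) = - snd (ys ! i) \<and>
      half_sign B (f i) (fst (ys ! Suc i)) = snd (ys ! Suc i)"
    unfolding step_def by metis
  define T where "T = \<lparr>vseq = map fst ys,
    eseq = map (\<lambda>i. \<lparr>tail = fst (ys ! i), edge = f i, head = fst (ys ! Suc i)\<rparr>) [0..<n]\<rparr>"
  have ly: "length ys = Suc n" by (simp add: ys_def n_def)
  have n: "0 < n" using xs by (simp add: n_def)
  have vert: "fst (ys ! i) \<in> verts B \<and> fst (ys ! Suc i) \<in> verts B" if "i < n" for i
    using f[OF that] B by (auto simp: bidirected_graph_def)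
  have verts: "fst (ys ! i) \<in> verts B" if "i < Suc n" for i
    using vert[of i] vert[of "i - 1"] that n by (cases "i = n") auto
  have dist': "distinct (butlast (vseq T))" using dist by (simp add: T_def ys_def)
  have tr: "trail B T"
  proof (rule trailI[OF _ _ dist'])
    show "set (vseq T) \<subseteq> verts B" using verts ly
      by (auto simp: T_def set_conv_nth)
  qed (use f ly in \<open>auto simp: T_def oriented_edge_of_def\<close>)
  have "path B (remove_last T)"
    unfolding path_def
  proof
    show "distinct (vseq (remove_last T))" using dist' by (simp add: remove_last_def)
    show "trail B (remove_last T)" using tr n by (intro trail_remove_last) (auto simp: T_def)
  qed
  with tr have "almost_path B T" by (simp add: almost_path_def)
  moreover have "vseq T = map fst (xs @ [b])" by (simp add: T_def ys_def)
  ultimately show ?thesis by blast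
qed

text \<open>
  At index 0, where no edge arrives, the sign is chosen such that the rule "leave with the
  opposite of the arrival sign" holds there too.
\<close>

definition arrival :: "('v, 'e) bigraph \<Rightarrow> ('v, 'e) walk \<Rightarrow> nat \<Rightarrow> 'v \<times> sign" where
  "arrival B T i = (vseq T ! i,
     if i = 0 then - half_sign B (edge (eseq T ! 0)) (vseq T ! 0)
     else half_sign B (edge (eseq T ! (i - 1))) (vseq T ! i))"

lemma fst_arrival [simp]: "fst (arrival B T i) = vseq T ! i"
  by (simp add: arrival_def)

lemma hd_vseq: "trail B T \<Longrightarrow> hd (vseq T) = vseq T ! 0"
  by (metis hd_conv_nth list.size(3) nat.simps(3) trail_def)

lemma last_vseq: "trail B T \<Longrightarrow> last (vseq T) = vseq T ! length (eseq T)"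
  by (metis diff_Suc_1 last_conv_nth list.size(3) nat.simps(3) trail_def)

lemma path_nth_eq_iff:
  assumes "path B T" "i \<le> length (eseq T)" "j \<le> length (eseq T)"
  shows "vseq T ! i = vseq T ! j \<longleftrightarrow> i = j"
  using assms by (auto simp: path_def trail_def nth_eq_iff_index_eq)

lemma leaving_sign:
  assumes "trail B T" "i < length (eseq T)"
  shows "half_sign B (edge (eseq T ! i)) (vseq T ! i) = - snd (arrival B T i)"
  using assms by (cases i) (auto simp: trail_def arrival_def)

lemma step_arrival:
  assumes "path B T" "i < length (eseq T)"
  shows "step B (arrival B T i) (arrival B T (Suc i))"
proof -
  have "oriented_edge_of B (eseq T ! i)" "tail (eseq T ! i) = vseq T ! i"
    "head (eseq T ! i) = vseq T ! Suc i"
    using assms by (auto simp: path_def trail_def)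
  moreover have "vseq T ! i \<noteq> vseq T ! Suc i" using path_nth_eq_iff[of B T i "Suc i"] assms by auto
  moreover have "half_sign B (edge (eseq T ! i)) (vseq T ! i) = - snd (arrival B T i)"
    using leaving_sign assms by (auto simp: path_def)
  ultimately show ?thesis unfolding step_def
    by (intro bexI[of _ "edge (eseq T ! i)"]) (auto simp: oriented_edge_of_def arrival_def)
qed

section \<open>Inner vertices and splicing of paths\<close>

lemma in_inner_verts_iff:
  assumes "trail B T"
  shows "v \<in> inner_verts T \<longleftrightarrow> (\<exists>i. 0 < i \<and> i < length (eseq T) \<and> v = vseq T ! i)"
proof -
  have len: "length (vseq T) = Suc (length (eseq T))" using assms by (simp add: trail_def)
  have "v \<in> inner_verts T \<longleftrightarrow> (\<exists>i < length (eseq T) - 1. v = vseq T ! Suc i)"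
    using len by (auto simp: inner_verts_def in_set_conv_nth nth_butlast nth_tl)
  also have "\<dots> \<longleftrightarrow> (\<exists>i. 0 < i \<and> i < length (eseq T) \<and> v = vseq T ! i)"
    by (metis Suc_less_eq Suc_pred less_diff_conv Suc_eq_plus1 zero_less_Suc gr0_conv_Suc)
  finally show ?thesis .
qed

text \<open>The common vertex is taken from \<open>S\<close>, so \<open>T\<close> contributes its
  vertices after index \<open>j\<close>, but its edges from index \<open>j\<close> on, the first of
  which leaves the common vertex.\<close>

definition splice_walk :: "('v, 'e) walk \<Rightarrow> nat \<Rightarrow> ('v, 'e) walk \<Rightarrow> nat \<Rightarrow> ('v, 'e) walk" where
  "splice_walk S i T j = \<lparr>vseq = take (Suc i) (vseq S) @ drop (Suc j) (vseq T),
     eseq = take i (eseq S) @ drop j (eseq T)\<rparr>"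

lemma nth_splice_walk:
  assumes "trail B S" "trail B T" "i \<le> length (eseq S)" "j \<le> length (eseq T)"
    and eq: "vseq S ! i = vseq T ! j"
  shows "k \<le> i \<Longrightarrow> vseq (splice_walk S i T j) ! k = vseq S ! k"
    and "l \<le> length (eseq T) - j \<Longrightarrow> vseq (splice_walk S i T j) ! (i + l) = vseq T ! (j + l)"
    and "k < i \<Longrightarrow> eseq (splice_walk S i T j) ! k = eseq S ! k"
    and "l < length (eseq T) - j \<Longrightarrow> eseq (splice_walk S i T j) ! (i + l) = eseq T ! (j + l)"
    and "length (eseq (splice_walk S i T j)) = i + (length (eseq T) - j)"
    and "length (vseq (splice_walk S i T j)) = Suc (i + (length (eseq T) - j))"
proof -
  have len: "length (vseq S) = Suc (length (eseq S))" "length (vseq T) = Suc (length (eseq T))"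
    using assms by (auto simp: trail_def)
  show "k \<le> i \<Longrightarrow> vseq (splice_walk S i T j) ! k = vseq S ! k"
    using assms len by (auto simp: splice_walk_def nth_append)
  show "l \<le> length (eseq T) - j \<Longrightarrow> vseq (splice_walk S i T j) ! (i + l) = vseq T ! (j + l)"
    using assms len by (cases l) (auto simp: splice_walk_def nth_append)
  show "k < i \<Longrightarrow> eseq (splice_walk S i T j) ! k = eseq S ! k"
    using assms len by (auto simp: splice_walk_def nth_append)
  show "l < length (eseq T) - j \<Longrightarrow> eseq (splice_walk S i T j) ! (i + l) = eseq T ! (j + l)"
    using assms len by (auto simp: splice_walk_def nth_append)
  show "length (eseq (splice_walk S i T j)) = i + (length (eseq T) - j)"
    using assms len by (auto simp: splice_walk_def)
  show "length (vseq (splice_walk S i T j)) = Suc (i + (length (eseq T) - j))"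
    using assms len by (auto simp: splice_walk_def)
qed

text \<open>Equal arrival states mean that \<open>S\<close> enters the common vertex with the same
  sign as \<open>T\<close>, so the edge on which \<open>T\<close> leaves may follow the last edge
  taken from \<open>S\<close>.\<close>

lemma path_splice_walk:
  assumes S: "path B S" "i \<le> length (eseq S)" and T: "path B T" "j \<le> length (eseq T)"
    and pos: "0 < i" "0 < j" and eq: "arrival B S i = arrival B T j"
    and disj: "\<And>k l. k \<le> i \<Longrightarrow> j < l \<Longrightarrow> l \<le> length (eseq T) \<Longrightarrow> vseq S ! k \<noteq> vseq T ! l"
  shows "path B (splice_walk S i T j)"
proof -
  let ?R = "splice_walk S i T j"
  have tr: "trail B S" "trail B T" using S T by (auto simp: path_def)
  have veq: "vseq S ! i = vseq T ! j" using eq by (metis fst_arrival)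
  note R = nth_splice_walk[OF tr S(2) T(2) veq]
  have len: "length (vseq S) = Suc (length (eseq S))" "length (vseq T) = Suc (length (eseq T))"
    using tr by (auto simp: trail_def)
  have dist: "distinct (vseq ?R)"
  proof -
    have "set (take (Suc i) (vseq S)) \<inter> set (drop (Suc j) (vseq T)) = {}"
      using disj len S(2) by (auto simp: set_conv_nth)
    then show ?thesis using S T by (simp add: splice_walk_def path_def)
  qed
  have "trail B ?R"
  proof (rule trailI)
    show "length (vseq ?R) = Suc (length (eseq ?R))" using R(5,6) by simp
    show "set (vseq ?R) \<subseteq> verts B"
      using tr by (auto simp: splice_walk_def trail_def dest!: in_set_takeD in_set_dropD)
    show "distinct (butlast (vseq ?R))" using dist by (rule distinct_butlast)
  next
    fix k assume k: "k < length (eseq ?R)"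
    show "oriented_edge_of B (eseq ?R ! k) \<and> tail (eseq ?R ! k) = vseq ?R ! k \<and>
        head (eseq ?R ! k) = vseq ?R ! Suc k"
    proof (cases "k < i")
      case True
      then show ?thesis using tr(1) S(2) R(1)[of k] R(1)[of "Suc k"] R(3)[of k]
        by (simp add: trail_def)
    next
      case False
      then obtain l where l: "k = i + l" by (metis le_add_diff_inverse linorder_not_less)
      then show ?thesis using tr(2) k R(2)[of l] R(2)[of "Suc l"] R(4)[of l] R(5)
        by (simp add: trail_def)
    qed
  next
    fix k assume k: "Suc k < length (eseq ?R)"
    consider "Suc k < i" | "Suc k = i" | l where "k = i + l"
      by (metis Suc_lessI le_add_diff_inverse linorder_not_less)
    then show "half_sign B (edge (eseq ?R ! Suc k)) (vseq ?R ! Suc k) =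
        - half_sign B (edge (eseq ?R ! k)) (vseq ?R ! Suc k)"
    proof cases
      case 1
      then show ?thesis using tr(1) S(2) R(1)[of "Suc k"] R(3)[of k] R(3)[of "Suc k"]
        by (simp add: trail_def)
    next
      case 2
      then have "eseq ?R ! Suc k = eseq T ! j" "j < length (eseq T)" "eseq ?R ! k = eseq S ! k"
        "vseq ?R ! Suc k = vseq S ! i"
        using R(4)[of 0] R(3)[of k] R(1)[of i] k R(5) by auto
      \<comment> \<open>The junction: \<open>i\<close> and \<open>j\<close> are positive, so both
        arrival signs are those of actual edges.\<close>
      then show ?thesis using leaving_sign[OF tr(2), of j] veq eq 2
        by (auto simp: arrival_def split: if_splits)
    next
      case (3 l)
      then show ?thesis using tr(2) k R(2)[of "Suc l"] R(4)[of l] R(4)[of "Suc l"] R(5)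
        by (simp add: trail_def)
    qed
  qed
  then show ?thesis using dist by (simp add: path_def)
qed

lemma inner_verts_splice_walk:
  assumes "path B S" "i < length (eseq S)" "path B T" "j < length (eseq T)"
    and "0 < i" "vseq S ! i = vseq T ! j" "path B (splice_walk S i T j)" "v \<in> inner_verts (splice_walk S i T j)"
  shows "(\<exists>k. 0 < k \<and> k \<le> i \<and> v = vseq S ! k) \<or> (\<exists>l. j < l \<and> l < length (eseq T) \<and> v = vseq T ! l)"
proof -
  have tr: "trail B S" "trail B T" "trail B (splice_walk S i T j)" using assms by (auto simp: path_def)
  note R = nth_splice_walk[OF tr(1,2) _ _ assms(6)]
  obtain k where k: "0 < k" "k < length (eseq (splice_walk S i T j))" "v = vseq (splice_walk S i T j) ! k"
    using assms(8) in_inner_verts_iff[OF tr(3)] by blast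
  show ?thesis
  proof (cases "k \<le> i")
    case True
    then show ?thesis using k R(1)[of k] assms(2,4) by auto
  next
    case False
    then obtain l where l: "k = i + l" "0 < l" by (metis less_imp_add_positive linorder_not_less)
    then have "j + l < length (eseq T)" "v = vseq T ! (j + l)"
      using k R(2)[of l] R(5) assms(2,4) by auto
    then show ?thesis using l(2) by (intro disjI2 exI[of _ "j + l"]) auto
  qed
qed

subsection \<open>Disjoint path systems\<close>

text \<open>An inner vertex has a unique path and position in a disjoint system
  (\<open>disjoint_paths_unique\<close>), which makes this relation a strict partial order.\<close>

definition before :: "('v, 'e) walk set \<Rightarrow> 'v \<Rightarrow> 'v \<Rightarrow> bool" where
  "before \<P> v w \<longleftrightarrow> (\<exists>P\<in>\<P>. \<exists>i j. 0 < i \<and> i < j \<and> j < length (eseq P) \<and> v = vseq P ! i \<and> w = vseq P ! j)"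

lemma disjoint_paths_unique:
  assumes "disjoint_paths B u v \<P>" "P \<in> \<P>" "P' \<in> \<P>"
    and "0 < i" "i < length (eseq P)" "0 < i'" "i' < length (eseq P')" "vseq P ! i = vseq P' ! i'"
  shows "P = P' \<and> i = i'"
proof -
  have paths: "path B P" "path B P'" using assms by (auto simp: disjoint_paths_def)
  then have "vseq P ! i \<in> inner_verts P" "vseq P' ! i' \<in> inner_verts P'"
    using assms(4-7) by (auto simp: path_def in_inner_verts_iff)
  then have "\<not> disjnt (inner_verts P) (inner_verts P')" using assms(8) by (auto simp: disjnt_iff)
  then have "P = P'" using assms(1-3) unfolding disjoint_paths_def pairwise_def by blast
  then show ?thesis using paths assms path_nth_eq_iff[of B P i i'] by auto
qed

lemma before_nth_iff:
  assumes "disjoint_paths B u v \<P>" "P \<in> \<P>" "0 < i" "i < length (eseq P)" "0 < j" "j < length (eseq P)"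
  shows "before \<P> (vseq P ! i) (vseq P ! j) \<longleftrightarrow> i < j"
proof
  assume "before \<P> (vseq P ! i) (vseq P ! j)"
  then obtain P' i' j' where "P' \<in> \<P>" "0 < i'" "i' < j'" "j' < length (eseq P')"
    "vseq P ! i = vseq P' ! i'" "vseq P ! j = vseq P' ! j'" by (auto simp: before_def)
  moreover from this have "P = P' \<and> i = i'" "P = P' \<and> j = j'"
    using disjoint_paths_unique[OF assms(1,2), of P' i i'] disjoint_paths_unique[OF assms(1,2), of P' j j']
      assms by auto
  ultimately show "i < j" by simp
qed (use assms in \<open>auto simp: before_def\<close>)

lemma before_irrefl:
  assumes "disjoint_paths B u v \<P>"
  shows "\<not> before \<P> a a"
proof
  assume "before \<P> a a"
  then obtain P i j where "P \<in> \<P>" "0 < i" "i < j" "j < length (eseq P)" "vseq P ! i = vseq P ! j"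
    by (auto simp: before_def)
  then show False using disjoint_paths_unique[OF assms, of P P i j] by auto
qed

lemma before_trans:
  assumes "disjoint_paths B u v \<P>" "before \<P> a b" "before \<P> b c"
  shows "before \<P> a c"
proof -
  obtain P i j where P: "P \<in> \<P>" "0 < i" "i < j" "j < length (eseq P)" "a = vseq P ! i" "b = vseq P ! j"
    using assms(2) by (auto simp: before_def)
  obtain P' j' k where P': "P' \<in> \<P>" "0 < j'" "j' < k" "k < length (eseq P')" "b = vseq P' ! j'" "c = vseq P' ! k"
    using assms(3) by (auto simp: before_def)
  have "P = P' \<and> j = j'" using disjoint_paths_unique[OF assms(1) P(1) P'(1), of j j'] P P' by auto
  then show ?thesis using P P' unfolding before_def by (metis less_trans)
qed

lemma before_inner_verts:
  assumes "disjoint_paths B u v \<P>" "P \<in> \<P>" "w \<in> inner_verts P"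
  shows "before \<P> s w \<Longrightarrow> s \<in> inner_verts P" and "before \<P> w s \<Longrightarrow> s \<in> inner_verts P"
proof -
  have tr: "trail B P" using assms by (auto simp: disjoint_paths_def path_def)
  obtain i where i: "0 < i" "i < length (eseq P)" "w = vseq P ! i"
    using assms(3) in_inner_verts_iff[OF tr] by blast
  show "s \<in> inner_verts P" if sw: "before \<P> s w"
  proof -
    obtain P' k l where P': "P' \<in> \<P>" "0 < k" "k < l" "l < length (eseq P')"
      "s = vseq P' ! k" "w = vseq P' ! l" using sw unfolding before_def by blast
    then have "P' = P" using i
      by (intro conjunct1[OF disjoint_paths_unique[OF assms(1) P'(1) assms(2), of l i]]) auto
    then show ?thesis unfolding in_inner_verts_iff[OF tr] using P'
      by (intro exI[of _ k]) simp
  qed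
  show "s \<in> inner_verts P" if sw: "before \<P> w s"
  proof -
    obtain P' k l where P': "P' \<in> \<P>" "0 < k" "k < l" "l < length (eseq P')"
      "w = vseq P' ! k" "s = vseq P' ! l" using sw unfolding before_def by blast
    then have "P' = P" using i
      by (intro conjunct1[OF disjoint_paths_unique[OF assms(1) P'(1) assms(2), of k i]]) auto
    then show ?thesis unfolding in_inner_verts_iff[OF tr] using P'
      by (intro exI[of _ l]) simp
  qed
qed

section \<open>Bases on paths of a clean bidirected graph, and the construction of the new path
  system\<close>

locale clean_bigraph =
  fixes B :: "('v, 'e) bigraph" and r :: 'v
  assumes bidirected: "bidirected_graph B" and clean: "clean B r"

text \<open>A walk of states returning to the root would become, by \<open>walk_of_states\<close>, a
  nontrivial almost path from \<open>r\<close> to \<open>r\<close>.\<close>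

sublocale clean_bigraph \<subseteq> clean_states "step B" r
proof
  fix xs b
  assume xs: "xs \<noteq> []" "fst (hd xs) = r" "successively (step B) (xs @ [b])" "distinct (map fst xs)"
  from walk_of_states[OF bidirected xs(1,3,4)] obtain T
    where T: "almost_path B T" "vseq T = map fst (xs @ [b])" by auto
  have "joins T r (fst b)" using T xs by (simp add: joins_def hd_map hd_append)
  moreover have "\<not> trivial T"
    using T xs(1) by (auto simp: almost_path_def trail_def trivial_def)
  ultimately show "fst b \<noteq> r" using clean T(1) by (auto simp: clean_def)
qed (rule step_opp)

context clean_bigraph
begin

lemma spath_arrivals:
  assumes "path B P" "i \<le> j" "j \<le> length (eseq P)"
  shows "spath (map (arrival B P) [i..<Suc j])"
  unfolding spath_def
proof (intro conjI)
  show "successively (step B) (map (arrival B P) [i..<Suc j])"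
    unfolding successively_conv_nth
    using assms step_arrival[OF assms(1)] by (auto simp del: upt_Suc)
  show "distinct (map fst (map (arrival B P) [i..<Suc j]))"
    using assms path_nth_eq_iff[OF assms(1)] by (auto simp: distinct_map inj_on_def comp_def simp del: upt_Suc)
qed (use assms in auto)

lemma reach_arrival:
  assumes "path B P" "hd (vseq P) = r" "i \<le> length (eseq P)"
  shows "reach (arrival B P i)"
proof -
  have "vseq P ! 0 = r" using assms(1,2) hd_vseq by (metis path_def)
  then show ?thesis using spath_arrivals[OF assms(1) _ assms(3), of 0]
    unfolding reach_def by (intro exI[of _ "map (arrival B P) [0..<Suc i]"]) (auto simp: hd_map last_map simp del: upt_Suc)
qed

text \<open>Both states are reachable, and a non-root vertex that is not double has only one
  reachable state. This is what permits switching between paths there.\<close>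

lemma arrival_unique:
  assumes "path B P" "hd (vseq P) = r" "i \<le> length (eseq P)"
    and "path B Q" "hd (vseq Q) = r" "j \<le> length (eseq Q)"
    and "vseq P ! i = vseq Q ! j" "vseq P ! i \<noteq> r" "\<not> double (vseq P ! i)"
  shows "arrival B P i = arrival B Q j"
  using reach_arrival[OF assms(1-3)] reach_arrival[OF assms(4-6)] assms(7-9)
  by (intro base_unique reach_not_double_base) auto

lemma path_last_base:
  assumes "path B P" "hd (vseq P) = r" "i \<le> length (eseq P)" "double (vseq P ! i)"
  shows "\<exists>k<i. blossom_path (arrival B P k) (map (arrival B P) [Suc k..<Suc i])"
proof -
  let ?xs = "map (arrival B P) [0..<Suc i]"
  have "vseq P ! 0 = r" using assms(1,2) hd_vseq by (metis path_def)
  then have "fst (hd ?xs) = r" by (simp add: hd_map del: upt_Suc)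
  then obtain ys b zs where s: "?xs = ys @ b # zs" "zs \<noteq> []" "blossom_path b zs"
    using last_base[of ?xs] spath_arrivals[OF assms(1) _ assms(3), of 0] assms(4) by auto
  define k where "k = length ys"
  have "length ?xs = Suc (k + length zs)" by (subst s(1)) (simp add: k_def)
  then have k: "k < i" using s(2) by (cases zs) auto
  have "b = ?xs ! k" using s(1) by (simp add: k_def del: upt_Suc)
  then have "b = arrival B P k" using k by (simp del: upt_Suc)
  moreover have "zs = drop (Suc k) ?xs" using s(1) by (simp add: k_def del: upt_Suc)
  then have "zs = map (arrival B P) [Suc k..<Suc i]" by (simp add: drop_map del: upt_Suc)
  ultimately show ?thesis using s(3) k by blast
qed

text \<open>The last non-double vertices before the meeting point agree by
  \<open>blossom_paths_same_base\<close>. The final conclusion serves to exclude switching vertices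
  on \<open>Q\<close> between the base and the meeting point.\<close>

lemma common_last_base:
  assumes P: "path B P" "hd (vseq P) = r" "i \<le> length (eseq P)"
    and Q: "path B Q" "hd (vseq Q) = r" "j \<le> length (eseq Q)"
    and w: "vseq P ! i = vseq Q ! j" "double (vseq P ! i)"
  obtains k l where "0 < k" "k < i" "0 < l" "l < j" "vseq P ! k = vseq Q ! l" "\<not> double (vseq P ! k)"
    "\<And>m. l < m \<Longrightarrow> m \<le> j \<Longrightarrow> double (vseq Q ! m)"
proof -
  obtain k where k: "k < i" "blossom_path (arrival B P k) (map (arrival B P) [Suc k..<Suc i])"
    using path_last_base[OF P w(2)] by blast
  obtain l where l: "l < j" "blossom_path (arrival B Q l) (map (arrival B Q) [Suc l..<Suc j])"
    using path_last_base[OF Q] w by auto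
  have "arrival B P k = arrival B Q l"
    by (rule blossom_paths_same_base[OF k(2) _ l(2)]) (use k l w in auto)
  then have eq: "vseq P ! k = vseq Q ! l" by (metis fst_arrival)
  have b: "base (arrival B P k)" "base (arrival B Q l)" using k l by (auto simp: blossom_path_def)
  have "vseq P ! 0 = r" "vseq Q ! 0 = r" using P Q hd_vseq by (metis path_def)+
  then have "0 < k" "0 < l" using base_not_root[OF b(1)] base_not_root[OF b(2)]
    by (metis fst_arrival gr0I)+
  moreover have "\<not> double (vseq P ! k)" using base_not_double[OF b(1)] by simp
  moreover have "double (vseq Q ! m)" if "l < m" "m \<le> j" for m
    using l(2) that by (auto simp: blossom_path_def)
  ultimately show thesis using that k l eq by blast
qed

lemma linkage:
  assumes fin: "finite (verts B)" and xr: "x \<noteq> r"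
    and P: "disjoint_paths B r x \<P>" and Q: "disjoint_paths B r x \<Q>"
  shows "\<exists>\<R>. disjoint_paths B r x \<R> \<and>
           (\<forall>P \<in> \<P>. \<exists>R \<in> \<R>. first_edge P \<in> edges_on R) \<and>
           (\<forall>Q \<in> \<Q>. \<exists>R \<in> \<R>. last_edge Q \<in> edges_on R)"
proof -
  have facts: "path B T \<and> trail B T \<and> hd (vseq T) = r \<and> last (vseq T) = x \<and> vseq T ! 0 = r \<and>
      vseq T ! length (eseq T) = x \<and> 0 < length (eseq T)"
    if "T \<in> \<P> \<union> \<Q>" for T
  proof -
    have *: "path B T" "trail B T" "hd (vseq T) = r" "last (vseq T) = x"
      using that P Q by (auto simp: disjoint_paths_def joins_def path_def)
    moreover have "vseq T ! 0 = r" "vseq T ! length (eseq T) = x"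
      using * hd_vseq last_vseq by metis+
    ultimately show ?thesis using xr by (auto intro: gr0I)
  qed
  note inner = in_inner_verts_iff[of B]
  define C where "C = {v \<in> \<Union> (inner_verts ` \<P>) \<inter> \<Union> (inner_verts ` \<Q>). \<not> double v}"
  have "C \<subseteq> verts B"
  proof
    fix v assume "v \<in> C"
    then obtain T where "T \<in> \<P>" "v \<in> inner_verts T" by (auto simp: C_def)
    then show "v \<in> verts B" using facts[of T] inner[of T v] by (auto simp: trail_def)
  qed
  then have "finite C" using fin finite_subset by blast
  then have "\<exists>S\<subseteq>C. (\<forall>c\<in>S. \<forall>d\<in>S. \<not> before \<P> c d \<and> \<not> before \<Q> c d) \<and>
      (\<forall>c\<in>C - S. (\<exists>d\<in>S. before \<P> d c) \<or> (\<exists>d\<in>S. before \<Q> c d))"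
    by (rule kernel_of_two_orders)
      (fact before_irrefl[OF P] before_irrefl[OF Q] before_trans[OF P] before_trans[OF Q])+
  then obtain S where S: "S \<subseteq> C"
    and S1: "\<forall>c\<in>S. \<forall>d\<in>S. \<not> before \<P> c d \<and> \<not> before \<Q> c d"
    and S2: "\<forall>c\<in>C - S. (\<exists>d\<in>S. before \<P> d c) \<or> (\<exists>d\<in>S. before \<Q> c d)"
    by (elim exE conjE) (rule that)
  have anti: "\<not> before \<P> c d \<and> \<not> before \<Q> c d" if "c \<in> S" "d \<in> S" for c d
    using S1 that by (elim ballE) auto
  have dom: "(\<exists>d\<in>S. before \<P> d c) \<or> (\<exists>d\<in>S. before \<Q> c d)" if "c \<in> C" "c \<notin> S" for c
    by (rule bspec[OF S2]) (use that in simp)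
  \<comment> \<open>Both the splicing and the disjointness rest on this: a common inner vertex with
    no vertex of \<open>S\<close> before it on \<open>p\<close> and none after it on
    \<open>q\<close> is itself in \<open>S\<close>.\<close>
  have early_late: "w \<in> S"
    if p: "p \<in> \<P>" "0 < i" "i < length (eseq p)" and q: "q \<in> \<Q>" "0 < j" "j < length (eseq q)"
      and w: "w = vseq p ! i" "w = vseq q ! j"
      and early: "\<And>s. s \<in> S \<Longrightarrow> \<not> before \<P> s w" and late: "\<And>s. s \<in> S \<Longrightarrow> \<not> before \<Q> w s"
    for p i q j w
  proof (cases "double w")
    case False
    then have "w \<in> C" using p q w inner[of p w] inner[of q w] facts[of p] facts[of q]
      unfolding C_def by blast
    then show ?thesis using dom early late by blast
  next
    case True
    obtain k l where kl: "0 < k" "k < i" "0 < l" "l < j" "vseq p ! k = vseq q ! l"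
      "\<not> double (vseq p ! k)" "\<And>m. l < m \<Longrightarrow> m \<le> j \<Longrightarrow> double (vseq q ! m)"
      by (rule common_last_base[of p i q j]) (use facts[of p] facts[of q] p q w True in auto)
    define b where "b = vseq p ! k"
    have bw: "before \<P> b w" "before \<Q> b w"
      using p q w kl unfolding before_def b_def by blast+
    have bC: "b \<in> C" using p q kl inner[of p b] inner[of q b] facts[of p] facts[of q]
      unfolding C_def b_def by auto
    \<comment> \<open>The base \<open>b\<close> precedes \<open>w\<close> on \<open>p\<close>, so
      neither \<open>b\<close> nor a vertex before it on \<open>p\<close> is in \<open>S\<close>.
      Hence \<open>b\<close> is dominated by a later vertex \<open>s\<close> on
      \<open>q\<close>.\<close>
    have "b \<notin> S" using bw early by blast
    moreover have "\<not> before \<P> s b" if "s \<in> S" for s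
      using early[OF that] before_trans[OF P _ bw(1)] by blast
    ultimately obtain s where s: "s \<in> S" "before \<Q> b s" using dom bC by blast
    then obtain q' l' m where m: "q' \<in> \<Q>" "0 < l'" "l' < m" "m < length (eseq q')" "b = vseq q' ! l'"
      "s = vseq q' ! m" by (auto simp: before_def)
    have "q = q' \<and> l = l'" using disjoint_paths_unique[OF Q q(1) m(1), of l l'] kl m q
      by (auto simp: b_def)
    then have m': "l < m" "m < length (eseq q)" "s = vseq q ! m" using m by auto
    have "\<not> double s" using s(1) S by (auto simp: C_def)
    \<comment> \<open>All vertices of \<open>q\<close> after \<open>b\<close> up to \<open>w\<close>
      are double and \<open>s\<close> is not, so \<open>s\<close> comes after \<open>w\<close>,
      contradicting \<open>late\<close>.\<close>
    then have "j < m" using kl(7)[of m] m' by (metis linorder_not_less)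
    then have "before \<Q> w s" using m' q w unfolding before_def by blast
    then show ?thesis using late s(1) by blast
  qed
  define switch where "switch p i q j \<longleftrightarrow> p \<in> \<P> \<and> q \<in> \<Q> \<and> 0 < i \<and> i < length (eseq p) \<and>
      0 < j \<and> j < length (eseq q) \<and> vseq p ! i = vseq q ! j \<and> vseq p ! i \<in> S" for p i q j
  \<comment> \<open>A spliced path plays both roles. Each path of \<P> determines the only
    \<open>R\<close> that it starts, each path of \<Q> the only \<open>R\<close> that it
    finishes.\<close>
  define starts where "starts p R \<longleftrightarrow> p \<in> \<P> \<and> (R = p \<and> inner_verts p \<inter> S = {} \<or>
      (\<exists>q i j. switch p i q j \<and> R = splice_walk p i q j))" for p R
  define finishes where "finishes q R \<longleftrightarrow> q \<in> \<Q> \<and> (R = q \<and> inner_verts q \<inter> S = {} \<or>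
      (\<exists>p i j. switch p i q j \<and> R = splice_walk p i q j))" for q R
  define \<R> where "\<R> = {R. (\<exists>p. starts p R) \<or> (\<exists>q. finishes q R)}"
  \<comment> \<open>Inner vertices of one path are comparable and those in \<open>S\<close> are not,
    so each path has at most one of them in \<open>S\<close>.\<close>
  have on_P: "i = i'" if "p \<in> \<P>" "0 < i" "i < length (eseq p)" "vseq p ! i \<in> S"
    "0 < i'" "i' < length (eseq p)" "vseq p ! i' \<in> S" for p i i'
    using before_nth_iff[OF P] anti that by (metis nat_neq_iff)
  have on_Q: "i = i'" if "p \<in> \<Q>" "0 < i" "i < length (eseq p)" "vseq p ! i \<in> S"
    "0 < i'" "i' < length (eseq p)" "vseq p ! i' \<in> S" for p i i'
    using before_nth_iff[OF Q] anti that by (metis nat_neq_iff)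
  have switch_in: "vseq p ! i \<in> inner_verts p \<inter> S" "vseq q ! j \<in> inner_verts q \<inter> S"
    if "switch p i q j" for p i q j
    using that inner[of p] inner[of q] facts[of p] facts[of q] unfolding switch_def by auto
  have switch_unique_P: "i = i' \<and> q = q' \<and> j = j'" if "switch p i q j" "switch p i' q' j'" for p i q j i' q' j'
  proof -
    have "i = i'" using on_P[of p i i'] that by (auto simp: switch_def)
    then show ?thesis using disjoint_paths_unique[OF Q, of q q' j j'] that by (auto simp: switch_def)
  qed
  have switch_unique_Q: "p = p' \<and> i = i' \<and> j = j'" if "switch p i q j" "switch p' i' q j'" for p i q j p' i' j'
  proof -
    have "j = j'" using on_Q[of q j j'] that by (auto simp: switch_def)
    then show ?thesis using disjoint_paths_unique[OF P, of p p' i i'] that by (auto simp: switch_def)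
  qed
  have early_switch: "\<not> before \<P> s (vseq p ! k)" if "switch p i q j" "0 < k" "k \<le> i" "s \<in> S" for p i q j k s
  proof
    assume "before \<P> s (vseq p ! k)"
    moreover have "k = i \<or> before \<P> (vseq p ! k) (vseq p ! i)"
      using that before_nth_iff[OF P, of p k i] by (auto simp: switch_def)
    ultimately have "before \<P> s (vseq p ! i)" using before_trans[OF P] by blast
    then show False using anti that by (auto simp: switch_def)
  qed
  have late_switch: "\<not> before \<Q> (vseq q ! l) s"
    if "switch p i q j" "j \<le> l" "l < length (eseq q)" "s \<in> S" for p i q j l s
  proof
    assume "before \<Q> (vseq q ! l) s"
    moreover have "l = j \<or> before \<Q> (vseq q ! j) (vseq q ! l)"
      using that before_nth_iff[OF Q, of q j l] by (auto simp: switch_def)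
    ultimately have "before \<Q> (vseq q ! j) s" using before_trans[OF Q] by blast
    then show False using anti that by (auto simp: switch_def)
  qed
  have splice: "path B (splice_walk p i q j)" if sw: "switch p i q j" for p i q j
  proof (rule path_splice_walk)
    note sw' = sw[unfolded switch_def]
    show "path B p" "path B q" "i \<le> length (eseq p)" "j \<le> length (eseq q)" "0 < i" "0 < j"
      using sw' facts by auto
    have "vseq p ! i \<noteq> vseq p ! 0" using path_nth_eq_iff[of B p i 0] sw' facts[of p] by auto
    then have "vseq p ! i \<noteq> r" using sw' facts[of p] by auto
    moreover have "\<not> double (vseq p ! i)" using sw' S by (auto simp: C_def)
    ultimately show "arrival B p i = arrival B q j"
      using sw' facts[of p] facts[of q] by (intro arrival_unique) auto
    fix k l assume kl: "k \<le> i" "j < l" "l \<le> length (eseq q)"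
    show "vseq p ! k \<noteq> vseq q ! l"
    proof
      assume eq: "vseq p ! k = vseq q ! l"
      have "k \<noteq> 0"
      proof
        assume "k = 0"
        then have "vseq q ! l = vseq q ! 0" using eq facts[of p] facts[of q] sw' by auto
        then show False using path_nth_eq_iff[of B q l 0] facts[of q] sw' kl by auto
      qed
      moreover have "l \<noteq> length (eseq q)"
      proof
        assume "l = length (eseq q)"
        then have "vseq p ! k = vseq p ! length (eseq p)" using eq facts[of p] facts[of q] sw' by auto
        then show False using path_nth_eq_iff[of B p k "length (eseq p)"] facts[of p] sw' kl by auto
      qed
      ultimately have k: "0 < k" "k < length (eseq p)" "0 < l" "l < length (eseq q)" using kl sw' by auto
      \<comment> \<open>A further meeting would lie in \<open>S\<close> by
        \<open>early_late\<close>, hence be the switching vertex itself, but it sits after index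
        \<open>j\<close> on \<open>q\<close>.\<close>
      have "vseq p ! k \<in> S"
        by (rule early_late[of p k q l])
          (use k kl sw' eq early_switch[OF sw, of k] late_switch[OF sw, of l] in auto)
      then have "i = k" using on_P[of p i k] k sw' by auto
      then have "vseq q ! l = vseq q ! j" using eq sw' by auto
      then show False using path_nth_eq_iff[of B q l j] facts[of q] sw' kl by auto
    qed
  qed
  have splice_joins: "joins (splice_walk p i q j) r x" if sw: "switch p i q j" for p i q j
  proof -
    note sw' = sw[unfolded switch_def]
    have "vseq p \<noteq> []" "Suc j < length (vseq q)"
      using sw' facts[of p] facts[of q] by (auto simp: trail_def)
    then show ?thesis using facts[of p] facts[of q] sw' by (simp add: joins_def splice_walk_def hd_append)
  qed
  have paths: "path B R \<and> joins R r x" if "R \<in> \<R>" for R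
    using that splice splice_joins facts unfolding \<R>_def starts_def finishes_def joins_def by blast
  have starts_unique: "R = R'" if "starts p R" "starts p R'" for p R R'
    using that switch_in switch_unique_P unfolding starts_def by blast
  have finishes_unique: "R = R'" if "finishes q R" "finishes q R'" for q R R'
    using that switch_in switch_unique_Q unfolding finishes_def by blast
  \<comment> \<open>Each inner vertex of a new path lies on a kept initial part of some
    \<open>p\<close> or a kept final part of some \<open>q\<close>. Disjointness thus splits into
    \<open>same_start\<close>, \<open>same_finish\<close> and \<open>cross\<close>.\<close>
  have cover: "(\<exists>p i. starts p R \<and> 0 < i \<and> i < length (eseq p) \<and> w = vseq p ! i \<and> (\<forall>s\<in>S. \<not> before \<P> s w)) \<or>
      (\<exists>q j. finishes q R \<and> 0 < j \<and> j < length (eseq q) \<and> w = vseq q ! j \<and> (\<forall>s\<in>S. \<not> before \<Q> w s))"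
    if R: "R \<in> \<R>" and w: "w \<in> inner_verts R" for R w
  proof -
    consider (p) "R \<in> \<P>" "inner_verts R \<inter> S = {}" | (q) "R \<in> \<Q>" "inner_verts R \<inter> S = {}"
      | (s) p i q j where "switch p i q j" "R = splice_walk p i q j"
      using R unfolding \<R>_def starts_def finishes_def by blast
    then show ?thesis
    proof cases
      case p
      then obtain i where i: "0 < i" "i < length (eseq R)" "w = vseq R ! i"
        using w inner facts by blast
      have "\<not> before \<P> s w" if "s \<in> S" for s
        using before_inner_verts(1)[OF P p(1) w, of s] p(2) that by blast
      moreover have "starts R R" using p by (simp add: starts_def)
      ultimately show ?thesis using i by (intro disjI1 exI[of _ R] exI[of _ i] conjI ballI)
    next
      case q
      then obtain i where i: "0 < i" "i < length (eseq R)" "w = vseq R ! i"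
        using w inner facts by blast
      have "\<not> before \<Q> w s" if "s \<in> S" for s
        using before_inner_verts(2)[OF Q q(1) w, of s] q(2) that by blast
      moreover have "finishes R R" using q by (simp add: finishes_def)
      ultimately show ?thesis using i by (intro disjI2 exI[of _ R] exI[of _ i] conjI ballI)
    next
      case s
      note sw' = s(1)[unfolded switch_def]
      have "(\<exists>k. 0 < k \<and> k \<le> i \<and> w = vseq p ! k) \<or> (\<exists>l. j < l \<and> l < length (eseq q) \<and> w = vseq q ! l)"
        using sw' facts splice[OF s(1)] w by (intro inner_verts_splice_walk) (auto simp: s(2))
      then show ?thesis
      proof (elim disjE exE conjE)
        fix k assume k: "0 < k" "k \<le> i" "w = vseq p ! k"
        then have "starts p R" "k < length (eseq p)" using sw' s by (auto simp: starts_def)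
        then show ?thesis using k early_switch[OF s(1), of k]
          by (intro disjI1 exI[of _ p] exI[of _ k]) auto
      next
        fix l assume l: "j < l" "l < length (eseq q)" "w = vseq q ! l"
        then have "finishes q R" "0 < l" using sw' s by (auto simp: finishes_def)
        then show ?thesis using l late_switch[OF s(1), of l]
          by (intro disjI2 exI[of _ q] exI[of _ l]) auto
      qed
    qed
  qed
  have cross: "R = R'"
    if h: "starts p R" "0 < i" "i < length (eseq p)" "w = vseq p ! i" "\<forall>s\<in>S. \<not> before \<P> s w"
      "finishes q R'" "0 < j" "j < length (eseq q)" "w = vseq q ! j" "\<forall>s\<in>S. \<not> before \<Q> w s"
    for R R' p q i j w
  proof -
    have pq: "p \<in> \<P>" "q \<in> \<Q>" using h by (auto simp: starts_def finishes_def)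
    \<comment> \<open>So \<open>p\<close> and \<open>q\<close> switch at \<open>w\<close>, and by
      uniqueness both \<open>R\<close> and \<open>R'\<close> are the path spliced there.\<close>
    have "w \<in> S" using early_late[of p i q j w] pq h by blast
    then have "switch p i q j" using pq h by (auto simp: switch_def)
    then have "starts p (splice_walk p i q j)" "finishes q (splice_walk p i q j)"
      using pq by (auto simp: starts_def finishes_def)
    then show ?thesis using starts_unique finishes_unique h by blast
  qed
  have same_start: "R = R'" if "starts p R" "starts p' R'" "0 < i" "i < length (eseq p)"
    "0 < i'" "i' < length (eseq p')" "vseq p ! i = vseq p' ! i'" for p p' R R' i i'
  proof -
    have "p \<in> \<P>" "p' \<in> \<P>" using that(1,2) by (simp_all add: starts_def)
    then have "p = p'" by (rule conjunct1[OF disjoint_paths_unique[OF P _ _ that(3-7)]])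
    then show ?thesis using starts_unique that(1,2) by blast
  qed
  have same_finish: "R = R'" if "finishes q R" "finishes q' R'" "0 < i" "i < length (eseq q)"
    "0 < i'" "i' < length (eseq q')" "vseq q ! i = vseq q' ! i'" for q q' R R' i i'
  proof -
    have "q \<in> \<Q>" "q' \<in> \<Q>" using that(1,2) by (simp_all add: finishes_def)
    then have "q = q'" by (rule conjunct1[OF disjoint_paths_unique[OF Q _ _ that(3-7)]])
    then show ?thesis using finishes_unique that(1,2) by blast
  qed
  have disj: "R = R'" if R: "R \<in> \<R>" "R' \<in> \<R>" and w: "w \<in> inner_verts R" "w \<in> inner_verts R'" for R R' w
    using cover[OF R(1) w(1)] cover[OF R(2) w(2)]
  proof (elim disjE exE conjE)
    fix p i p' i' assume "starts p R" "0 < i" "i < length (eseq p)" "w = vseq p ! i"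
      "starts p' R'" "0 < i'" "i' < length (eseq p')" "w = vseq p' ! i'"
    then show ?thesis using same_start[of p R p' R' i i'] by simp
  next
    fix p i p' i' assume "finishes p R" "0 < i" "i < length (eseq p)" "w = vseq p ! i"
      "finishes p' R'" "0 < i'" "i' < length (eseq p')" "w = vseq p' ! i'"
    then show ?thesis using same_finish[of p R p' R' i i'] by simp
  next
    fix p i q j assume "starts p R" "0 < i" "i < length (eseq p)" "w = vseq p ! i" "\<forall>s\<in>S. \<not> before \<P> s w"
      "finishes q R'" "0 < j" "j < length (eseq q)" "w = vseq q ! j" "\<forall>s\<in>S. \<not> before \<Q> w s"
    then show ?thesis by (rule cross)
  next
    fix p i q j assume "finishes q R" "0 < j" "j < length (eseq q)" "w = vseq q ! j" "\<forall>s\<in>S. \<not> before \<Q> w s"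
      "starts p R'" "0 < i" "i < length (eseq p)" "w = vseq p ! i" "\<forall>s\<in>S. \<not> before \<P> s w"
    then show ?thesis using cross[of p R' i w q R j] by blast
  qed
  have "disjoint_paths B r x \<R>"
    using paths disj unfolding disjoint_paths_def pairwise_def disjnt_iff by blast
  moreover have "\<exists>R\<in>\<R>. first_edge p \<in> edges_on R" if p: "p \<in> \<P>" for p
  proof (cases "inner_verts p \<inter> S = {}")
    case True
    then have "p \<in> \<R>" using p by (auto simp: \<R>_def starts_def)
    moreover have "first_edge p \<in> edges_on p" using facts[of p] p
      by (auto simp: first_edge_def edges_on_def)
    ultimately show ?thesis by blast
  next
    case False
    then obtain i where i: "0 < i" "i < length (eseq p)" "vseq p ! i \<in> S"
      using inner[of p] facts[of p] p by auto
    then obtain q where q: "q \<in> \<Q>" "vseq p ! i \<in> inner_verts q" using S by (auto simp: C_def)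
    then obtain j where j: "0 < j" "j < length (eseq q)" "vseq p ! i = vseq q ! j"
      using inner[of q] facts[of q] by auto
    have "switch p i q j" using p q i j by (auto simp: switch_def)
    then have "starts p (splice_walk p i q j)" using p by (auto simp: starts_def)
    then have "splice_walk p i q j \<in> \<R>" by (auto simp: \<R>_def)
    \<comment> \<open>Switches happen at inner vertices only: \<open>i > 0\<close> keeps the first
      edge of \<open>p\<close>, just as \<open>j < length (eseq q)\<close> keeps the last edge of
      \<open>q\<close> below.\<close>
    moreover have "hd (eseq p) \<in> set (take i (eseq p))"
      using i by (cases "eseq p"; cases i) auto
    then have "first_edge p \<in> edges_on (splice_walk p i q j)"
      by (auto simp: first_edge_def edges_on_def splice_walk_def)
    ultimately show ?thesis by blast
  qed
  moreover have "\<exists>R\<in>\<R>. last_edge q \<in> edges_on R" if q: "q \<in> \<Q>" for q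
  proof (cases "inner_verts q \<inter> S = {}")
    case True
    then have "q \<in> \<R>" using q by (auto simp: \<R>_def finishes_def)
    moreover have "last_edge q \<in> edges_on q" using facts[of q] q
      by (auto simp: last_edge_def edges_on_def)
    ultimately show ?thesis by blast
  next
    case False
    then obtain j where j: "0 < j" "j < length (eseq q)" "vseq q ! j \<in> S"
      using inner[of q] facts[of q] q by auto
    then obtain p where p: "p \<in> \<P>" "vseq q ! j \<in> inner_verts p" using S by (auto simp: C_def)
    then obtain i where i: "0 < i" "i < length (eseq p)" "vseq q ! j = vseq p ! i"
      using inner[of p] facts[of p] by auto
    have "switch p i q j" using p q i j by (auto simp: switch_def)
    then have "finishes q (splice_walk p i q j)" using q by (auto simp: finishes_def)
    then have "splice_walk p i q j \<in> \<R>" by (auto simp: \<R>_def)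
    moreover have "last (eseq q) \<in> set (drop j (eseq q))"
      using j by (metis last_drop last_in_set drop_eq_Nil linorder_not_less)
    then have "last_edge q \<in> edges_on (splice_walk p i q j)"
      by (auto simp: last_edge_def edges_on_def splice_walk_def)
    ultimately show ?thesis by blast
  qed
  ultimately show ?thesis by blast
qed

end

theorem theorem7p10:
  fixes B :: "('v, 'e) bigraph" and r x :: 'v and \<P> \<Q> :: "('v, 'e) walk set"
  assumes "finite_bidirected_graph B"
    and "r \<in> verts B"
    and "clean B r"
    and "x \<in> verts B - {r}"
    and "disjoint_paths B r x \<P>"
    and "disjoint_paths B r x \<Q>"
  shows "\<exists>\<R>. disjoint_paths B r x \<R> \<and>
           (\<forall>P \<in> \<P>. \<exists>R \<in> \<R>. first_edge P \<in> edges_on R) \<and>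
           (\<forall>Q \<in> \<Q>. \<exists>R \<in> \<R>. last_edge Q \<in> edges_on R)"
proof -
  interpret clean_bigraph B r
    using assms by unfold_locales (auto simp: finite_bidirected_graph_def)
  show ?thesis using assms by (intro linkage) (auto simp: finite_bidirected_graph_def)
qed

end
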